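(* Let $A$ be a square matrix that has a well-defined logarithm $\ln A$. Then for any matrix $X_0=\ln A+\Delta_0$ with a self-adjoint initial deviation matrix $\Delta_0$ (that is, $\Delta_0=\Delta_0^\dagger$) satisfying $[\Delta_0,A]=0$, the iteration $$X_{n+1}=A\,e^{-X_n}-\mathbf{1}+X_n,\qquad n\ge 0,$$ is contractive and converges to $\ln A$, that is, $\lim_{n\to\infty}X_n=\ln A$.
   Context: Here $\mathbf{1}$ is the identity matrix of the same size as $A$, $e^{M}$ is the matrix exponential, $M^\dagger$ is the conjugate transpose of $M$, and $[M,N]=MN-NM$. The deviation matrices are $\Delta_n=X_n-\ln A$. "Contractive" refers to the deviation from the fixed point $\ln A$ becoming smaller in norm with each iteration, the norm being the operator norm $\|\Delta_n\|$ (for a positive semidefinite matrix, its largest eigenvalue). The matrix $A$ itself is not required to be self-adjoint.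
   Formalization: ln A is the principal logarithm (eigenvalues with imaginary part in (-π, π]). Strict decrease of the nonzero deviation norm is claimed for n ≥ 1, and for n = 0 only if Δ_0 is positive semidefinite, since the first step can increase it (1×1, Δ_0 = -2 gives Δ_1 = e²-3 > 2). *)

theory Defs
  imports "HOL-Analysis.Analysis"
begin

(* The type class operations *, 1, ^ (and hence exp) on complex^'n^'n are componentwise,
   so matrix powers and the matrix exponential are built from ** and mat 1. *)

primrec mpow :: "complex^'n^'n \<Rightarrow> nat \<Rightarrow> complex^'n^'n" where
  "mpow M 0 = mat 1"
| "mpow M (Suc k) = M ** mpow M k"

definition mexp :: "complex^'n^'n \<Rightarrow> complex^'n^'n" where
  "mexp M = (\<Sum>k. mpow M k /\<^sub>R fact k)"

definition mdagger :: "complex^'n^'n \<Rightarrow> complex^'n^'n" where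
  "mdagger M = map_matrix cnj (transpose M)"

definition self_adjoint :: "complex^'n^'n \<Rightarrow> bool" where
  "self_adjoint M \<longleftrightarrow> M = mdagger M"

definition commutator :: "complex^'n^'n \<Rightarrow> complex^'n^'n \<Rightarrow> complex^'n^'n" where
  "commutator M N = M ** N - N ** M"

(* Deviations satisfy D' = exp (- D) - 1 + D, which is positive semidefinite for self-adjoint D.
   Such a step decreases the norm if D is positive semidefinite, but not for every self-adjoint D:
   in dimension one, D = -2 gives D' = exp 2 - 3 > 2. *)

definition pos_semidef :: "complex^'n^'n \<Rightarrow> bool" where
  "pos_semidef M \<longleftrightarrow>
     self_adjoint M \<and> (\<forall>v. 0 \<le> Re (\<Sum>i\<in>UNIV. cnj (v $ i) * (M *v v) $ i))"

definition meigenvalue :: "complex^'n^'n \<Rightarrow> complex \<Rightarrow> bool" where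
  "meigenvalue M c \<longleftrightarrow> (\<exists>v. v \<noteq> 0 \<and> M *v v = c *s v)"

(* The principal matrix logarithm: exponential equal to A, spectrum in the strip
   -pi < Im z <= pi (the range of Ln on nonzero numbers). Without a fixed branch ln A would
   not be determined by A, and a matrix commuting with A need not commute with an arbitrary
   matrix whose exponential is A. *)

definition is_mlog :: "complex^'n^'n \<Rightarrow> complex^'n^'n \<Rightarrow> bool" where
  "is_mlog A L \<longleftrightarrow> mexp L = A \<and> (\<forall>c. meigenvalue L c \<longrightarrow> - pi < Im c \<and> Im c \<le> pi)"

definition has_mlog :: "complex^'n^'n \<Rightarrow> bool" where
  "has_mlog A \<longleftrightarrow> (\<exists>L. is_mlog A L)"

definition mlog :: "complex^'n^'n \<Rightarrow> complex^'n^'n" where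
  "mlog A = (THE L. is_mlog A L)"

(* The library norm on complex^'n^'n is the Frobenius norm, not the operator norm. *)

definition opnorm :: "complex^'n^'n \<Rightarrow> real" where
  "opnorm M = onorm ((*v) M)"

end

theory Submission
  imports Defs "HOL-Computational_Algebra.Fundamental_Theorem_Algebra"
begin

text \<open>
  Put $L = ln A$ and $D_n = X_n - L$. If $D_0$ commutes with $L$, then all $D_n$ do, and
  $e^L e^{-(L + D_n)} = e^{-D_n}$ turns the iteration into $D_{n+1} = f(D_n)$ with
  $f(x) = e^{-x} - 1 + x$ (lemma \<open>deviation_step\<close>). The matrices $D_n$ are self-adjoint and the
  eigenvalues of $f(D)$ are values of $f$ at eigenvalues of $D$ (\<open>eigenvalue_dev_step\<close>). As
  $f \<ge> 0$, from $n = 1$ on the deviations have non-negative spectrum. There $f$ is increasing, and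
  the norm of a self-adjoint matrix is the modulus of an eigenvalue
  (\<open>self_adjoint_opnorm_eigenvalue\<close>), so $\<parallel>D_{n+1}\<parallel> \<le> f(\<parallel>D_n\<parallel>)$ (\<open>opnorm_dev_step_le\<close>).
  Since $f(x) < x$ for $x > 0$, the norms decrease strictly while they are positive, and
  their limit is $0$ (\<open>step_fun_iteration_tendsto_0\<close>).

  It remains to see that $A$ determines $L$ and that a matrix commuting with $A = e^L$ commutes
  with $L$. Both are cases of one statement (\<open>intertwine_of_mexp_intertwine\<close>): if the spectra of $L$
  and $M$ lie in the strip $-\<pi> < Im z \<le> \<pi>$, then $e^L B = B e^M$ implies $L B = B M$. Taking $B = 1$
  gives uniqueness, and taking $M = L$ gives the commutation. The proof studies the operator
  $C \<mapsto> L C - C M$, whose eigenvalues are differences of eigenvalues of $L$ and $M$.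

  In place of a Jordan decomposition or a full spectral theorem, eigenvectors come from
  \<open>ex_shift_prod_eigenvalues\<close>: each vector of an invariant set is annihilated by a product of
  factors $T - c$ in which every $c$ has an eigenvector in that set.
\<close>

section \<open>Annihilating products of linear factors\<close>

lemma span_image_obtain_coeffs:
  fixes f :: "nat \<Rightarrow> 'a::real_vector"
  assumes "x \<in> span (f ` {..<n})"
  obtains u where "x = (\<Sum>i<n. u i *\<^sub>R f i)"
proof -
  have "x \<in> span (f ` {..<n}) \<Longrightarrow> \<exists>u. x = (\<Sum>i<n. u i *\<^sub>R f i)"
  proof (induction n arbitrary: x)
    case 0
    then show ?case by simp
  next
    case (Suc n)
    then obtain k where "x - k *\<^sub>R f n \<in> span (f ` {..<n})"
      by (auto simp: lessThan_Suc span_breakdown_eq)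
    then obtain u where u: "x - k *\<^sub>R f n = (\<Sum>i<n. u i *\<^sub>R f i)"
      using Suc.IH by blast
    have "x = (\<Sum>i<Suc n. (u(n := k)) i *\<^sub>R f i)"
      using u by (simp add: algebra_simps)
    then show ?case by blast
  qed
  with assms that show thesis by blast
qed

text \<open>
  The dependence is taken over the reals, so that one statement serves vectors and matrices alike:
  both are Euclidean spaces, with the same kind of real scalar multiplication.
\<close>

lemma ex_in_span_of_previous:
  fixes f :: "nat \<Rightarrow> 'a::euclidean_space"
  obtains n where "f n \<in> span (f ` {..<n})"
proof (rule ccontr)
  assume "\<not> thesis"
  with that have no: "f n \<notin> span (f ` {..<n})" for n by blast
  have "independent (f ` {..<n}) \<and> card (f ` {..<n}) = n" for n
  proof (induction n)
    case 0
    then show ?case by (simp add: independent_empty)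
  next
    case (Suc n)
    have "f n \<notin> f ` {..<n}" using no[of n] by (meson span_base)
    with Suc no[of n] show ?case by (auto simp: lessThan_Suc independent_insertI)
  qed
  from this[of "Suc DIM('a)"] have "Suc DIM('a) \<le> DIM('a)"
    using independent_bound[of "f ` {..<Suc DIM('a)}"] by auto
  then show False by simp
qed

text \<open>
  A complex-linear operator on a space that is finite-dimensional as a real space. The scalar
  multiplication is a parameter because the operators below act on vectors (by a matrix) and on
  matrices (by the Sylvester operator).
\<close>

locale complex_operator = Vector_Spaces.linear sc sc T
  for sc :: "complex \<Rightarrow> 'a::euclidean_space \<Rightarrow> 'a" and T :: "'a \<Rightarrow> 'a" +
  assumes sc_of_real: "sc (of_real r) x = r *\<^sub>R x"
begin

definition shift_prod :: "complex list \<Rightarrow> 'a \<Rightarrow> 'a"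
  where "shift_prod cs = foldr (\<lambda>c x. T x - sc c x) cs"

lemma shift_prod_Nil [simp]: "shift_prod [] v = v"
  and shift_prod_Cons [simp]: "shift_prod (c # cs) v = T (shift_prod cs v) - sc c (shift_prod cs v)"
  and shift_prod_append: "shift_prod (bs @ cs) v = shift_prod bs (shift_prod cs v)"
  by (simp_all add: shift_prod_def)

text \<open>
  All factors are polynomials in the same operator, so any one of them can be moved through the
  others.
\<close>

lemma shift_prod_commutes:
  "shift_prod cs (T v - sc c v) = T (shift_prod cs v) - sc c (shift_prod cs v)"
  by (induction cs) (simp_all add: diff scale vs1.scale_right_diff_distrib mult.commute)

text \<open>
  The value at $v$ of a polynomial in the operator. The summation bound is separate from the degree
  so that both sides of a factorisation can be summed over matching ranges.
\<close>

definition poly_apply :: "complex poly \<Rightarrow> nat \<Rightarrow> 'a \<Rightarrow> 'a"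
  where "poly_apply p N v = (\<Sum>i\<le>N. sc (coeff p i) ((T ^^ i) v))"

lemma funpow_T_shift: "(T ^^ i) (T v - sc z v) = (T ^^ Suc i) v - sc z ((T ^^ i) v)"
  by (induction i) (simp_all add: diff scale)

lemma poly_apply_linear_factor_times:
  assumes "degree q \<le> N"
  shows "poly_apply ([:-z, 1:] * q) (Suc N) v = poly_apply q N (T v - sc z v)"
proof -
  have top: "coeff q (Suc N) = 0" using assms by (simp add: coeff_eq_0)
  have "poly_apply ([:-z, 1:] * q) (Suc N) v
      = (\<Sum>i\<le>Suc N. sc (coeff (pCons 0 q) i) ((T ^^ i) v))
        - (\<Sum>i\<le>Suc N. sc (z * coeff q i) ((T ^^ i) v))"
    by (simp add: poly_apply_def sum_subtractf vs1.scale_left_diff_distrib del: sum.atMost_Suc)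
  also have "(\<Sum>i\<le>Suc N. sc (coeff (pCons 0 q) i) ((T ^^ i) v))
      = (\<Sum>i\<le>N. sc (coeff q i) ((T ^^ Suc i) v))"
    by (subst sum.atMost_Suc_shift) simp
  also have "(\<Sum>i\<le>Suc N. sc (z * coeff q i) ((T ^^ i) v))
      = (\<Sum>i\<le>N. sc (coeff q i) (sc z ((T ^^ i) v)))"
    by (simp add: top mult.commute)
  finally show ?thesis
    by (simp add: poly_apply_def funpow_T_shift vs1.scale_right_diff_distrib sum_subtractf del: funpow.simps)
qed

lemma ex_shift_prod_if_poly_apply:
  assumes "p \<noteq> 0" "degree p = n" "poly_apply p n v = 0"
  shows "\<exists>cs. shift_prod cs v = 0"
  using assms
proof (induction n arbitrary: p v)
  case 0
  then have "sc (coeff p 0) v = 0" "coeff p 0 \<noteq> 0"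
    using leading_coeff_0_iff[of p] by (auto simp: poly_apply_def)
  then have "shift_prod [] v = 0" by simp
  then show ?case by blast
next
  case (Suc n)
  then have "\<not> constant (poly p)" by (simp add: constant_degree)
  then obtain z where "poly p z = 0" using fundamental_theorem_of_algebra by blast
  then obtain q where q: "p = [:-z, 1:] * q" by (metis dvdE poly_eq_0_iff_dvd)
  with Suc.prems have "q \<noteq> 0" by auto
  then have "degree p = Suc (degree q)" unfolding q
    by (subst degree_mult_eq) auto
  then have dq: "degree q = n" using Suc.prems by simp
  with Suc.prems q have "poly_apply q n (T v - sc z v) = 0"
    using poly_apply_linear_factor_times[of q n z v] by simp
  from Suc.IH[OF \<open>q \<noteq> 0\<close> dq this] obtain cs where "shift_prod cs (T v - sc z v) = 0" by blast
  then have "shift_prod (cs @ [z]) v = 0" by (simp add: shift_prod_append)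
  then show ?case by blast
qed

text \<open>
  Finite dimension gives a monic polynomial in the operator that annihilates the vector, and over the
  complex numbers it splits into linear factors.
\<close>

lemma ex_shift_prod: "\<exists>cs. shift_prod cs v = 0"
proof -
  obtain n where "(T ^^ n) v \<in> span ((\<lambda>i. (T ^^ i) v) ` {..<n})"
    using ex_in_span_of_previous[of "\<lambda>i. (T ^^ i) v"] .
  then obtain u where u: "(T ^^ n) v = (\<Sum>i<n. u i *\<^sub>R (T ^^ i) v)"
    using span_image_obtain_coeffs by blast
  define p where "p = monom 1 n - (\<Sum>i<n. monom (complex_of_real (u i)) i)"
  have c: "coeff p i = (if i = n then 1 else if i < n then - of_real (u i) else 0)" for i
    by (simp add: p_def coeff_sum)
  have "p \<noteq> 0" using c[of n] by auto
  moreover have "degree p = n"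
    by (intro antisym degree_le le_degree) (simp_all add: c)
  moreover have "poly_apply p n v = 0"
    unfolding poly_apply_def by (simp add: c u sc_of_real sum_negf lessThan_Suc_atMost[symmetric])
  ultimately show ?thesis by (rule ex_shift_prod_if_poly_apply)
qed

text \<open>
  This replaces the decomposition into generalised eigenspaces. In an annihilating product of minimal
  length, removing one factor leaves a non-zero vector, which that factor kills: an eigenvector.
  It is obtained from $v$ by applying factors only, so it inherits every property
  preserved by the factors, and $V$ expresses such a property.
\<close>

lemma ex_shift_prod_eigenvalues:
  assumes V: "v \<in> V" "\<And>x c. x \<in> V \<Longrightarrow> T x - sc c x \<in> V"
  obtains cs where "shift_prod cs v = 0"
    "\<And>c. c \<in> set cs \<Longrightarrow> \<exists>w\<in>V. w \<noteq> 0 \<and> T w = sc c w"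
proof -
  obtain cs where cs: "shift_prod cs v = 0"
    and least: "\<And>bs. shift_prod bs v = 0 \<Longrightarrow> length cs \<le> length bs"
  proof -
    obtain cs0 where "shift_prod cs0 v = 0" using ex_shift_prod by blast
    from ex_has_least_nat[of "\<lambda>cs. shift_prod cs v = 0", OF this, of length] that
    show thesis by blast
  qed
  have "\<exists>w\<in>V. w \<noteq> 0 \<and> T w = sc c w" if "c \<in> set cs" for c
  proof -
    from that obtain as bs where cs_eq: "cs = as @ c # bs" by (meson split_list)
    let ?w = "shift_prod (as @ bs) v"
    have "shift_prod ds v \<in> V" for ds by (induction ds) (simp_all add: V)
    moreover have "?w \<noteq> 0" using least[of "as @ bs"] cs_eq by auto
    moreover have "T ?w - sc c ?w = 0"
      using cs by (simp add: cs_eq shift_prod_append shift_prod_commutes)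
    ultimately show ?thesis by auto
  qed
  with cs that show thesis by blast
qed

end

section \<open>The matrix exponential\<close>

lemma linear_matrix_mul_left: "linear (\<lambda>M :: complex^'n^'n. C ** M)"
  by (rule linearI)
    (simp_all add: vec_eq_iff matrix_matrix_mult_def scaleR_sum_right sum.distrib distrib_left)

lemma linear_matrix_mul_right: "linear (\<lambda>M :: complex^'n^'n. M ** C)"
  by (rule linearI)
    (simp_all add: vec_eq_iff matrix_matrix_mult_def scaleR_sum_right sum.distrib distrib_right)

lemma linear_matrix_apply: "linear (\<lambda>M :: complex^'n^'n. M *v w)"
  by (rule linearI)
    (simp_all add: vec_eq_iff matrix_vector_mult_def scaleR_sum_right sum.distrib distrib_right)

lemmas mul_left_diff = linear_diff[OF linear_matrix_mul_left]
  and mul_left_neg = linear_neg[OF linear_matrix_mul_left]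
  and mul_left_scaleR = linear_scale[OF linear_matrix_mul_left]
  and mul_left_sum = linear_sum[OF linear_matrix_mul_left]
  and mul_right_diff = linear_diff[OF linear_matrix_mul_right]
  and mul_right_add = linear_add[OF linear_matrix_mul_right]
  and mul_right_neg = linear_neg[OF linear_matrix_mul_right]
  and mul_right_scaleR = linear_scale[OF linear_matrix_mul_right]

lemma linear_sums:
  fixes f :: "'a::euclidean_space \<Rightarrow> 'b::real_normed_vector"
  assumes "linear f" "X sums a"
  shows "(\<lambda>n. f (X n)) sums f a"
  using assms bounded_linear.sums linear_conv_bounded_linear by blast

lemma norm_matrix_apply_le: "norm (M *v w) \<le> opnorm M * norm w" for M :: "complex^'n^'n"
  unfolding opnorm_def by (rule onorm) simp

lemma opnorm_nonneg: "0 \<le> opnorm M"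
  unfolding opnorm_def by (rule onorm_pos_le) simp

lemma matrix_apply_axis: "(M *v axis j 1) $ i = M $ i $ j" for M :: "complex^'n^'n"
  by (simp add: matrix_vector_mult_def axis_def if_distrib cong: if_cong)

lemma axis_norm: "norm (axis j 1 :: complex^'n) = 1"
  by (simp add: norm_vec_def L2_set_def axis_def if_distrib[of norm] if_distrib[of "\<lambda>x. x\<^sup>2"] cong: if_cong)

lemma norm_entry_le_opnorm: "norm (M $ i $ j) \<le> opnorm M" for M :: "complex^'n^'n"
proof -
  have "norm (M $ i $ j) \<le> norm (M *v axis j 1)"
    using Finite_Cartesian_Product.norm_nth_le[of "M *v axis j 1" i] by (simp add: matrix_apply_axis)
  also have "\<dots> \<le> opnorm M"
    using norm_matrix_apply_le[of M "axis j 1"] by (simp add: axis_norm)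
  finally show ?thesis .
qed

lemma opnorm_pos: "M \<noteq> 0 \<Longrightarrow> 0 < opnorm M"
  using norm_entry_le_opnorm[of M] opnorm_nonneg[of M]
  by (smt (verit) vec_eq_iff zero_index norm_le_zero_iff)

lemma opnorm_mpow_le: "opnorm (mpow M k) \<le> opnorm M ^ k"
proof -
  have "norm (mpow M k *v w) \<le> opnorm M ^ k * norm w" for w
  proof (induction k)
    case (Suc k)
    have "norm (mpow M (Suc k) *v w) \<le> opnorm M * norm (mpow M k *v w)"
      by (simp add: norm_matrix_apply_le flip: matrix_vector_mul_assoc)
    also have "\<dots> \<le> opnorm M * (opnorm M ^ k * norm w)"
      by (intro mult_left_mono Suc.IH opnorm_nonneg)
    finally show ?case by (simp add: mult.assoc)
  qed simp
  then show ?thesis unfolding opnorm_def[of "mpow M k"] by (rule onorm_le)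
qed

definition exp_term :: "complex^'n^'n \<Rightarrow> nat \<Rightarrow> complex^'n^'n"
  where "exp_term M k = mpow M k /\<^sub>R fact k"

lemma exp_term_0 [simp]: "exp_term M 0 = mat 1"
  by (simp add: exp_term_def)

lemma exp_term_Suc: "real (Suc k) *\<^sub>R exp_term M (Suc k) = M ** exp_term M k"
proof -
  have "real (Suc k) *\<^sub>R exp_term M (Suc k) = (real (Suc k) / fact (Suc k)) *\<^sub>R (M ** mpow M k)"
    by (simp add: exp_term_def divide_inverse del: of_nat_Suc fact_Suc)
  also have "real (Suc k) / fact (Suc k) = inverse (fact k)"
    by (simp add: divide_simps del: of_nat_Suc)
  finally show ?thesis by (simp add: exp_term_def mul_left_scaleR)
qed

lemma summable_norm_exp_term_entry: "summable (\<lambda>k. norm (exp_term M k $ i $ j))"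
proof (rule summable_comparison_test')
  show "summable (\<lambda>k. opnorm M ^ k /\<^sub>R fact k)"
    by (rule summable_exp_generic)
  fix k
  have "norm (mpow M k $ i $ j) \<le> opnorm M ^ k"
    using norm_entry_le_opnorm opnorm_mpow_le order_trans by blast
  then show "norm (norm (exp_term M k $ i $ j)) \<le> opnorm M ^ k /\<^sub>R fact k"
    by (simp add: exp_term_def divide_simps)
qed

lemma matrix_sumsI:
  fixes X :: "nat \<Rightarrow> complex^'n^'n"
  assumes "\<And>i j. (\<lambda>k. X k $ i $ j) sums (S $ i $ j)"
  shows "X sums S"
  using assms unfolding sums_def by (intro vec_tendstoI) simp

lemma exp_term_sums: "exp_term M sums mexp M"
proof -
  have "exp_term M sums (\<chi> i j. \<Sum>k. exp_term M k $ i $ j)"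
    by (rule matrix_sumsI) (simp add: summable_norm_cancel summable_norm_exp_term_entry summable_sums)
  then have "summable (exp_term M)" by (rule sums_summable)
  then show ?thesis
    by (simp add: mexp_def exp_term_def[abs_def] summable_sums)
qed

lemma exp_term_entry_sums: "(\<lambda>k. exp_term M k $ i $ j) sums (mexp M $ i $ j)"
  using linear_sums[OF _ exp_term_sums, of "\<lambda>M. M $ i $ j" M]
  by (simp add: linearI)

lemma mpow_intertwine:
  assumes "L ** C = C ** M"
  shows "mpow L k ** C = C ** mpow M k"
proof (induction k)
  case (Suc k)
  have "mpow L (Suc k) ** C = L ** (C ** mpow M k)"
    by (simp add: Suc flip: matrix_mul_assoc)
  then show ?case by (simp add: assms matrix_mul_assoc)
qed simp

lemma mexp_intertwine:
  assumes "L ** C = C ** M"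
  shows "mexp L ** C = C ** mexp M"
proof (rule sums_unique2)
  show "(\<lambda>k. exp_term L k ** C) sums (mexp L ** C)"
    by (rule linear_sums[OF linear_matrix_mul_right exp_term_sums])
  have "exp_term L k ** C = C ** exp_term M k" for k
    by (simp add: exp_term_def mul_left_scaleR mul_right_scaleR mpow_intertwine[OF assms])
  then show "(\<lambda>k. exp_term L k ** C) sums (C ** mexp M)"
    using linear_sums[OF linear_matrix_mul_left exp_term_sums] by simp
qed

lemma exp_term_add:
  assumes comm: "M ** N = N ** M"
  shows "exp_term (M + N) n = (\<Sum>i\<le>n. exp_term M i ** exp_term N (n - i))"
proof (induction n)
  case (Suc n)
  let ?P = "\<lambda>i j. exp_term M i ** exp_term N j"
  have NM: "N ** exp_term M i = exp_term M i ** N" for i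
    by (simp add: exp_term_def mul_left_scaleR mul_right_scaleR mpow_intertwine[OF comm])
  have M: "M ** ?P i j = real (Suc i) *\<^sub>R ?P (Suc i) j" for i j
    by (simp only: matrix_mul_assoc flip: exp_term_Suc mul_right_scaleR)
  have N: "N ** ?P i j = real (Suc j) *\<^sub>R ?P i (Suc j)" for i j
    by (simp only: matrix_mul_assoc NM) (simp only: flip: matrix_mul_assoc exp_term_Suc mul_left_scaleR)
  have "real (Suc n) *\<^sub>R exp_term (M + N) (Suc n) = (M + N) ** (\<Sum>i\<le>n. ?P i (n - i))"
    by (simp only: exp_term_Suc Suc.IH)
  also have "\<dots> = (\<Sum>i\<le>n. real (Suc i) *\<^sub>R ?P (Suc i) (n - i))
                 + (\<Sum>i\<le>n. real (Suc (n - i)) *\<^sub>R ?P i (Suc (n - i)))"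
    by (simp only: mul_right_add mul_left_sum M N sum.distrib)
  also have "(\<Sum>i\<le>n. real (Suc i) *\<^sub>R ?P (Suc i) (n - i))
           = (\<Sum>i\<le>Suc n. real i *\<^sub>R ?P i (Suc n - i))"
    by (subst sum.atMost_Suc_shift) simp
  also have "(\<Sum>i\<le>n. real (Suc (n - i)) *\<^sub>R ?P i (Suc (n - i)))
           = (\<Sum>i\<le>Suc n. real (Suc n - i) *\<^sub>R ?P i (Suc n - i))"
    by (simp add: Suc_diff_le add_diff_eq)
  also have "(\<Sum>i\<le>Suc n. real i *\<^sub>R ?P i (Suc n - i))
           + (\<Sum>i\<le>Suc n. real (Suc n - i) *\<^sub>R ?P i (Suc n - i))
           = (\<Sum>i\<le>Suc n. real (Suc n) *\<^sub>R ?P i (Suc n - i))"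
    by (simp flip: sum.distrib scaleR_add_left of_nat_add)
  finally show ?case by (simp only: flip: scaleR_right.sum) simp
qed simp

text \<open>
  The multiplication of the type of matrices is entrywise, not the matrix product,
  so the Cauchy product is formed for the complex entries, whose exponential series converge
  absolutely.
\<close>

lemma mexp_add:
  assumes "M ** N = N ** M"
  shows "mexp (M + N) = mexp M ** mexp N"
proof (rule sums_unique2[OF exp_term_sums])
  show "exp_term (M + N) sums (mexp M ** mexp N)"
  proof (rule matrix_sumsI)
    fix i j
    have "(\<lambda>n. \<Sum>p\<le>n. exp_term M p $ i $ k * exp_term N (n - p) $ k $ j)
        sums (mexp M $ i $ k * mexp N $ k $ j)" for k
      using Cauchy_product_sums[OF summable_norm_exp_term_entry[of M i k]
          summable_norm_exp_term_entry[of N k j]]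
      by (simp add: sums_unique[OF exp_term_entry_sums])
    then have "(\<lambda>n. \<Sum>k\<in>UNIV. \<Sum>p\<le>n. exp_term M p $ i $ k * exp_term N (n - p) $ k $ j)
        sums (\<Sum>k\<in>UNIV. mexp M $ i $ k * mexp N $ k $ j)"
      by (intro sums_sum)
    then show "(\<lambda>n. exp_term (M + N) n $ i $ j) sums (mexp M ** mexp N) $ i $ j"
      by (subst (asm) sum.swap) (simp add: exp_term_add[OF assms] matrix_matrix_mult_def)
  qed
qed

lemma mexp_0 [simp]: "mexp (0 :: complex^'n^'n) = mat 1"
proof (rule sums_unique2[OF exp_term_sums])
  have "exp_term (0 :: complex^'n^'n) = (\<lambda>k. if k = 0 then mat 1 else 0)"
    by (rule ext) (auto simp: exp_term_def gr0_conv_Suc dest!: not0_implies_Suc)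
  then show "exp_term (0 :: complex^'n^'n) sums mat 1"
    using sums_single[of 0 "\<lambda>_. mat 1 :: complex^'n^'n"] by simp
qed

lemma mexp_minus_left: "mexp (- M) ** mexp M = mat 1"
  using mexp_add[of "- M" M] by (simp add: mul_left_neg mul_right_neg)

lemma mexp_apply_eigenvector:
  assumes "M *v w = c *s w"
  shows "mexp M *v w = exp c *s w"
proof (rule sums_unique2)
  show "(\<lambda>k. exp_term M k *v w) sums (mexp M *v w)"
    by (rule linear_sums[OF linear_matrix_apply exp_term_sums])
  have "mpow M k *v w = c ^ k *s w" for k
    by (induction k)
      (simp_all add: assms vec.scale mult.commute flip: matrix_vector_mul_assoc)
  then have "exp_term M k *v w = (c ^ k /\<^sub>R fact k) *s w" for k
    by (simp add: exp_term_def linear_scale[OF linear_matrix_apply] vec_eq_iff)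
  moreover have "linear (\<lambda>c. c *s w)"
    by (rule linearI) (simp_all add: vec_eq_iff distrib_right)
  ultimately show "(\<lambda>k. exp_term M k *v w) sums (exp c *s w)"
    using linear_sums[OF _ exp_converges] by simp
qed

lemma mat_apply: "mat c *v w = c *s w" for w :: "complex^'n"
  by (simp add: matrix_vector_mult_def mat_def vec_eq_iff if_distrib if_distribR cong: if_cong)

lemma mexp_mat: "mexp (mat c :: complex^'n^'n) = mat (exp c)"
proof -
  have "mexp (mat c) *v w = mat (exp c) *v w" for w :: "complex^'n"
    by (simp only: mexp_apply_eigenvector mat_apply)
  then show ?thesis by (simp add: matrix_eq)
qed

section \<open>Exponentials with spectrum in the principal strip\<close>

lemma mat_mul_entry: "(mat c ** C) $ i $ j = c * C $ i $ j" for C :: "complex^'n^'n"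
  by (simp add: matrix_matrix_mult_def mat_def if_distrib if_distribR cong: if_cong)

lemma mul_mat_commute: "C ** mat c = mat c ** C" for C :: "complex^'n^'n"
  by (simp add: vec_eq_iff mat_mul_entry)
    (simp add: matrix_matrix_mult_def mat_def if_distrib if_distribR mult.commute cong: if_cong)

lemma complex_operator_apply: "complex_operator (*s) ((*v) M)" for M :: "complex^'n^'n"
  by (intro complex_operator.intro complex_operator_axioms.intro matrix_vector_mul_linear_gen)
    (simp add: vec_eq_iff scaleR_conv_of_real[where x = "_ :: complex"])

text \<open>
  The equation $L C = C M$ says that $C$ is in the kernel of this operator.
\<close>

lemma complex_operator_sylvester:
  "complex_operator (\<lambda>c C. mat c ** C) (\<lambda>C. L ** C - C ** M)" for L M :: "complex^'n^'n"
proof unfold_locales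
  fix c :: complex and C :: "complex^'n^'n"
  have "L ** (mat c ** C) = mat c ** (L ** C)"
    by (simp only: matrix_mul_assoc mul_mat_commute)
  then show "L ** (mat c ** C) - mat c ** C ** M = mat c ** (L ** C - C ** M)"
    by (simp add: mul_left_diff flip: matrix_mul_assoc)
qed (auto simp: vec_eq_iff mat_mul_entry scaleR_conv_of_real[where x = "_ :: complex"] algebra_simps matrix_add_ldistrib mul_right_add)

text \<open>
  The eigenvalues of the Sylvester operator are differences of eigenvalues of $L$ and $M$. Take $v$
  outside the kernel of $C$ and apply to it, one at a time, the factors $M - c$ of an annihilating
  product: at some factor the vector enters the kernel, and just before that $C$ maps it to an
  eigenvector of $L$.
\<close>

lemma eigenvalues_of_sylvester_eigenmatrix:
  fixes L M C :: "complex^'n^'n"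
  assumes "C \<noteq> 0" "L ** C - C ** M = mat \<mu> ** C"
  obtains \<nu> where "meigenvalue M \<nu>" "meigenvalue L (\<nu> + \<mu>)"
proof -
  interpret M: complex_operator "(*s)" "(*v) M" by (rule complex_operator_apply)
  obtain v where v: "C *v v \<noteq> 0"
    using \<open>C \<noteq> 0\<close> matrix_eq[of C 0] by auto
  obtain cs where cs: "M.shift_prod cs v = 0" "\<And>c. c \<in> set cs \<Longrightarrow> meigenvalue M c"
    using M.ex_shift_prod_eigenvalues[of v UNIV] unfolding meigenvalue_def by auto
  have "C *v M.shift_prod cs v = 0 \<Longrightarrow>
      \<exists>c\<in>set cs. \<exists>w. C *v w \<noteq> 0 \<and> C *v (M *v w - c *s w) = 0"
  proof (induction cs)
    case (Cons c cs)
    then show ?case by (cases "C *v M.shift_prod cs v = 0") auto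
  qed (simp add: v)
  with cs obtain \<nu> w where \<nu>: "meigenvalue M \<nu>"
    and w: "C *v w \<noteq> 0" "C *v (M *v w) = \<nu> *s (C *v w)"
    by (auto simp: vec.diff vec.scale)
  have "L *v (C *v w) = (C ** M + mat \<mu> ** C) *v w"
    using assms(2) by (simp add: matrix_vector_mul_assoc algebra_simps)
  also have "\<dots> = (\<nu> + \<mu>) *s (C *v w)"
    by (simp add: matrix_vector_mult_add_rdistrib w mat_apply vec.scale_left_distrib
        flip: matrix_vector_mul_assoc)
  finally have "meigenvalue L (\<nu> + \<mu>)" using w unfolding meigenvalue_def by blast
  with \<nu> that show thesis by blast
qed

lemma mpow_commute: "M ** mpow M k = mpow M k ** M"
  using mpow_intertwine[of M M M k] by simp

lemma mpow_sylvester_Suc: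
  fixes L M C D :: "complex^'n^'n"
  assumes D: "L ** C - C ** M = D" and LD: "L ** D = D ** M"
  shows "mpow L (Suc k) ** C - C ** mpow M (Suc k) = real (Suc k) *\<^sub>R (mpow L k ** D)"
proof (induction k)
  case (Suc k)
  have "mpow L (Suc (Suc k)) ** C - C ** mpow M (Suc (Suc k))
      = L ** (mpow L (Suc k) ** C - C ** mpow M (Suc k)) + (L ** C - C ** M) ** mpow M (Suc k)"
    by (simp add: mul_left_diff mul_right_diff matrix_mul_assoc)
  also have "(L ** C - C ** M) ** mpow M (Suc k) = mpow L (Suc k) ** D"
    unfolding D using mpow_intertwine[OF LD, of "Suc k"] by (rule sym)
  also have "L ** (mpow L (Suc k) ** C - C ** mpow M (Suc k)) = real (Suc k) *\<^sub>R (mpow L (Suc k) ** D)"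
    unfolding Suc.IH mul_left_scaleR by (simp add: matrix_mul_assoc)
  also have "real (Suc k) *\<^sub>R (mpow L (Suc k) ** D) + mpow L (Suc k) ** D
      = real (Suc (Suc k)) *\<^sub>R (mpow L (Suc k) ** D)"
    by (simp only: of_nat_Suc[of "Suc k"] scaleR_left_distrib scaleR_one add.commute)
  finally show ?case .
qed (simp add: D)

text \<open>
  If the second iterate of the Sylvester operator vanishes at $C$, then the exponential series is
  differentiated exactly as in the scalar rule $(x^k)' = k x^{k-1}$.
\<close>

lemma mexp_sylvester:
  fixes L M C D :: "complex^'n^'n"
  assumes D: "L ** C - C ** M = D" and LD: "L ** D = D ** M"
  shows "mexp L ** C - C ** mexp M = mexp L ** D"
proof -
  let ?g = "\<lambda>k. exp_term L k ** C - C ** exp_term M k"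
  have "?g sums (mexp L ** C - C ** mexp M)"
    by (intro sums_diff linear_sums[OF linear_matrix_mul_right exp_term_sums]
        linear_sums[OF linear_matrix_mul_left exp_term_sums])
  then have "(\<lambda>k. ?g (Suc k)) sums (mexp L ** C - C ** mexp M)"
    by (subst sums_Suc_iff) simp
  moreover have "?g (Suc k) = exp_term L k ** D" for k
  proof -
    have "?g (Suc k) = (mpow L (Suc k) ** C - C ** mpow M (Suc k)) /\<^sub>R fact (Suc k)"
      by (simp only: exp_term_def mul_left_scaleR mul_right_scaleR scaleR_right_diff_distrib)
    also have "\<dots> = (real (Suc k) / fact (Suc k)) *\<^sub>R (mpow L k ** D)"
      unfolding mpow_sylvester_Suc[OF assms] by (simp add: divide_inverse mult.commute del: of_nat_Suc fact_Suc)
    also have "real (Suc k) / fact (Suc k) = inverse (fact k)"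
      by (simp add: divide_simps del: of_nat_Suc)
    finally show ?thesis by (simp add: exp_term_def mul_right_scaleR)
  qed
  ultimately have "(\<lambda>k. exp_term L k ** D) sums (mexp L ** C - C ** mexp M)" by simp
  then show ?thesis
    using linear_sums[OF linear_matrix_mul_right exp_term_sums] sums_unique2 by blast
qed

lemma mexp_mul_eq_0_iff: "mexp L ** C = 0 \<longleftrightarrow> C = 0" for L C :: "complex^'n^'n"
proof
  assume "mexp L ** C = 0"
  then have "mexp (- L) ** (mexp L ** C) = 0"
    by (simp add: linear_0[OF linear_matrix_mul_left])
  then show "C = 0" by (simp add: matrix_mul_assoc mexp_minus_left)
qed (simp add: linear_0[OF linear_matrix_mul_left])

text \<open>
  The solutions $C$ of $e^L C = C e^M$ form a space $V$ that is invariant under the Sylvester operator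
  $S$. If $S C = \<mu> C$ with $0 \<noteq> C \<in> V$, then $L C = C (M + \<mu>)$, hence $e^L C = e^\<mu> e^L C$ and
  $e^\<mu> = 1$; since $\<mu>$ is a difference of numbers in a strip of width $2\<pi>$, this forces $\<mu> = 0$.
  So some power of $S$ annihilates $B$. On $V$ the kernels of $S$ and of $S^2$ coincide, because
  $S^2 C = 0$ gives $0 = e^L C - C e^M = e^L S C$. Therefore $S B = 0$.
\<close>

lemma intertwine_of_mexp_intertwine:
  fixes L M B :: "complex^'n^'n"
  assumes L: "\<And>c. meigenvalue L c \<Longrightarrow> - pi < Im c \<and> Im c \<le> pi"
    and M: "\<And>c. meigenvalue M c \<Longrightarrow> - pi < Im c \<and> Im c \<le> pi"
    and B: "mexp L ** B = B ** mexp M"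
  shows "L ** B = B ** M"
proof -
  interpret S: complex_operator "\<lambda>c C. mat c ** C" "\<lambda>C. L ** C - C ** M"
    by (rule complex_operator_sylvester)
  define V where "V = {C. mexp L ** C = C ** mexp M}"
  have VL: "L ** C \<in> V" and VM: "C ** M \<in> V" and Vc: "mat c ** C \<in> V" if "C \<in> V" for C c
  proof -
    have C: "mexp L ** C = C ** mexp M" using that by (simp add: V_def)
    have "mexp L ** (L ** C) = L ** (mexp L ** C)"
      using mexp_intertwine[of L L L] by (simp add: matrix_mul_assoc)
    then show "L ** C \<in> V" by (simp add: V_def C matrix_mul_assoc)
    have "mexp L ** (C ** M) = C ** (mexp M ** M)"
      by (simp add: matrix_mul_assoc C)
    then show "C ** M \<in> V"
      using mexp_intertwine[of M M M] by (simp add: V_def flip: matrix_mul_assoc)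
    have "mexp L ** (mat c ** C) = mat c ** (mexp L ** C)"
      by (simp only: matrix_mul_assoc mul_mat_commute)
    then show "mat c ** C \<in> V" by (simp add: V_def C matrix_mul_assoc)
  qed
  have Vdiff: "C - D \<in> V" if "C \<in> V" "D \<in> V" for C D
    using that by (simp add: V_def mul_left_diff mul_right_diff)
  have BV: "B \<in> V" using B by (simp add: V_def)
  have SV: "(L ** C - C ** M) - mat c ** C \<in> V" if "C \<in> V" for C c
    using that by (intro Vdiff VL VM Vc)
  obtain cs where cs: "S.shift_prod cs B = 0"
    "\<And>c. c \<in> set cs \<Longrightarrow> \<exists>C\<in>V. C \<noteq> 0 \<and> L ** C - C ** M = mat c ** C"
  proof (rule S.ex_shift_prod_eigenvalues[OF BV SV])
    fix cs
    assume "S.shift_prod cs B = 0"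
      "\<And>c. c \<in> set cs \<Longrightarrow> \<exists>C\<in>V. C \<noteq> 0 \<and> L ** C - C ** M = mat c ** C"
    then show thesis by (rule that)
  qed
  have zero: "\<mu> = 0" if \<mu>: "\<mu> \<in> set cs" for \<mu>
  proof -
    obtain C where C: "C \<in> V" "C \<noteq> 0" "L ** C - C ** M = mat \<mu> ** C"
      using cs(2)[OF \<mu>] by blast
    obtain \<nu> where \<nu>: "meigenvalue M \<nu>" "meigenvalue L (\<nu> + \<mu>)"
      using eigenvalues_of_sylvester_eigenmatrix[OF C(2,3)] .
    have "L ** C = C ** (mat \<mu> + M)"
      using C(3) by (simp add: matrix_add_ldistrib mul_mat_commute algebra_simps)
    from mexp_intertwine[OF this]
    have "mexp L ** C = C ** (mat (exp \<mu>) ** mexp M)"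
      by (simp add: mexp_add mul_mat_commute mexp_mat)
    also have "\<dots> = mat (exp \<mu>) ** (C ** mexp M)"
      by (simp only: matrix_mul_assoc mul_mat_commute)
    also have "\<dots> = mat (exp \<mu>) ** (mexp L ** C)" using C(1) by (simp add: V_def)
    finally have eq: "mexp L ** C = mat (exp \<mu>) ** (mexp L ** C)" .
    have "mexp L ** C \<noteq> 0" using \<open>C \<noteq> 0\<close> by (simp add: mexp_mul_eq_0_iff)
    then obtain i j where "(mexp L ** C) $ i $ j \<noteq> 0" by (auto simp: vec_eq_iff)
    moreover have "(mexp L ** C) $ i $ j = exp \<mu> * (mexp L ** C) $ i $ j"
      by (metis eq mat_mul_entry)
    ultimately have "exp \<mu> = 1" by simp
    then obtain n :: int where n: "Re \<mu> = 0" "Im \<mu> = of_int (2 * n) * pi"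
      by (auto simp: exp_eq_1)
    have "\<bar>Im \<mu>\<bar> < 2 * pi" using L[OF \<nu>(2)] M[OF \<nu>(1)] by auto
    then have "\<bar>real_of_int n\<bar> < 1"
      using n by (simp add: abs_mult)
    then have "n = 0" by linarith
    with n show ?thesis by (simp add: complex_eq_iff)
  qed
  \<comment> \<open>The operator has no Jordan block of size two for the eigenvalue zero on V.\<close>
  have step: "L ** C - C ** M = 0"
    if "C \<in> V" "L ** (L ** C - C ** M) = (L ** C - C ** M) ** M" for C
    using mexp_sylvester[OF refl that(2)] that(1)
    by (simp add: V_def mexp_mul_eq_0_iff)
  have "L ** B - B ** M = 0" if "S.shift_prod cs B = 0" "set cs \<subseteq> {0}" for cs
    using that
  proof (induction cs)
    case Nil
    then show ?case by (simp add: linear_0[OF linear_matrix_mul_left] linear_0[OF linear_matrix_mul_right])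
  next
    case (Cons c cs)
    let ?Q = "\<lambda>ds. S.shift_prod ds B"
    have c: "L ** ?Q cs - ?Q cs ** M = 0" using Cons.prems by simp
    have QV: "?Q ds \<in> V" for ds by (induction ds) (simp_all add: BV SV)
    show ?case
    proof (cases cs)
      case Nil
      with c show ?thesis by simp
    next
      case (Cons d ds)
      with \<open>set (c # cs) \<subseteq> {0}\<close> have "?Q cs = L ** ?Q ds - ?Q ds ** M" by simp
      with c step[OF QV, of ds] have "?Q cs = 0" by simp
      then show ?thesis using Cons.IH \<open>set (c # cs) \<subseteq> {0}\<close> by simp
    qed
  qed
  from this[OF cs(1)] zero have "L ** B - B ** M = 0" by (simp add: subset_iff)
  then show ?thesis by simp
qed

text \<open>
  Uniqueness of the principal logarithm is the case $B = 1$ of the intertwining property.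
\<close>

lemma mlog_eq:
  assumes "is_mlog A L"
  shows "mlog A = L"
  unfolding mlog_def
proof (rule the_equality[where P = "is_mlog A", OF assms])
  fix M
  assume "is_mlog A M"
  with assms have "M ** mat 1 = mat 1 ** L"
    by - (rule intertwine_of_mexp_intertwine, auto simp: is_mlog_def)
  then show "M = L" by simp
qed

section \<open>Self-adjoint matrices\<close>

lemma inner_complex_eq: "z \<bullet> w = Re (cnj z * w)" for z w :: complex
  by (simp add: inner_complex_def)

lemma inner_matrix_apply: "(M *v x) \<bullet> y = x \<bullet> (mdagger M *v y)" for M :: "complex^'n^'n"
proof -
  have "(M *v x) \<bullet> y = Re (\<Sum>i\<in>UNIV. \<Sum>j\<in>UNIV. cnj (M $ i $ j * x $ j) * y $ i)"
    by (simp add: inner_vec_def inner_complex_eq matrix_vector_mult_def sum_distrib_right)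
  also have "\<dots> = Re (\<Sum>j\<in>UNIV. \<Sum>i\<in>UNIV. cnj (x $ j) * (cnj (M $ i $ j) * y $ i))"
    by (subst sum.swap) (simp add: mult_ac)
  also have "\<dots> = x \<bullet> (mdagger M *v y)"
    by (simp add: inner_vec_def inner_complex_eq matrix_vector_mult_def sum_distrib_left
        mdagger_def transpose_def)
  finally show ?thesis .
qed

text \<open>
  The real inner product of the underlying real space, which is the real part of the Hermitian
  product, is enough: no complex inner product is set up.
\<close>

lemma self_adjoint_inner:
  assumes "self_adjoint D"
  shows "(D *v x) \<bullet> y = x \<bullet> (D *v y)"
  using inner_matrix_apply[of D x y] assms by (simp add: self_adjoint_def)

lemma self_adjoint_eigenvalue_real:
  assumes "self_adjoint D" "D *v w = c *s w" "w \<noteq> 0"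
  shows "c = of_real (Re c)"
proof -
  have split: "c *s w = Re c *\<^sub>R w + Im c *\<^sub>R (\<i> *s w)"
    by (simp add: vec_eq_iff complex_eq_iff)
  have i: "w \<bullet> (\<i> *s w) = 0"
    by (simp add: inner_vec_def inner_complex_def)
  have "(D *v w) \<bullet> (\<i> *s w) = w \<bullet> (\<i> *s (D *v w))"
    using self_adjoint_inner[OF assms(1)] by (simp add: vec.scale)
  also have "\<dots> = - ((D *v w) \<bullet> (\<i> *s w))"
    by (simp add: inner_vec_def inner_complex_def sum_negf flip: minus_add_distrib) (simp add: algebra_simps sum_negf[symmetric])
  finally have "(c *s w) \<bullet> (\<i> *s w) = 0" using assms(2) by simp
  then have "Im c * ((\<i> *s w) \<bullet> (\<i> *s w)) = 0"
    by (simp add: split inner_add_left i)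
  moreover have "\<i> *s w \<noteq> 0" using \<open>w \<noteq> 0\<close> by (simp add: vec_eq_iff)
  ultimately have "Im c = 0" by simp
  then show ?thesis by (simp add: complex_eq_iff)
qed

lemma norm_smult_vec: "norm (c *s w) = norm c * norm w" for w :: "complex^'n"
  by (simp add: norm_vec_def norm_mult L2_set_right_distrib)

lemma eigenvalue_le_opnorm:
  fixes M :: "complex^'n^'n"
  assumes "M *v w = c *s w" "w \<noteq> 0"
  shows "norm c \<le> opnorm M"
  using norm_matrix_apply_le[of M w] assms by (simp add: norm_smult_vec)

text \<open>
  Let $s$ be the operator norm, attained at the unit vector $v$. Then
  $|D^2 v - s^2 v|^2 = |D^2 v|^2 - 2 s^2 |D v|^2 + s^4 \<le> 0$, so $(D - s)(D + s) v = 0$: either $v$ is an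
  eigenvector for $-s$, or $(D + s) v$ is one for $s$. This gives the part of the spectral theorem
  needed here without diagonalising $D$.
\<close>

lemma self_adjoint_opnorm_eigenvalue:
  fixes D :: "complex^'n^'n"
  assumes "self_adjoint D"
  obtains \<mu> where "\<bar>\<mu>\<bar> = opnorm D" "meigenvalue D (of_real \<mu>)"
proof -
  let ?s = "opnorm D"
  have "compact (sphere (0 :: complex^'n) 1)" by simp
  moreover have "axis undefined 1 \<in> sphere (0 :: complex^'n) 1" by (simp add: axis_norm)
  moreover have "continuous_on (sphere 0 1) (\<lambda>x. norm (D *v x))"
    by (intro continuous_on_norm linear_continuous_on) simp
  ultimately obtain v where v: "norm v = 1"
    and max: "\<And>x. norm x = 1 \<Longrightarrow> norm (D *v x) \<le> norm (D *v v)"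
    using continuous_attains_sup[of "sphere (0 :: complex^'n) 1" "\<lambda>x. norm (D *v x)"] by auto
  have "norm (D *v x) \<le> norm (D *v v) * norm x" for x
  proof (cases "x = 0")
    case False
    then have "norm (D *v (x /\<^sub>R norm x)) \<le> norm (D *v v)" by (intro max) simp
    then show ?thesis using False
      by (simp add: linear_scale[OF matrix_vector_mul_linear] pos_divide_le_eq divide_inverse_commute[symmetric])
  qed simp
  then have "?s \<le> norm (D *v v)" unfolding opnorm_def by (rule onorm_le)
  with norm_matrix_apply_le[of D v] v have s: "norm (D *v v) = ?s" by simp
  let ?u = "D *v (D *v v)"
  have "norm ?u \<le> ?s\<^sup>2"
    using norm_matrix_apply_le[of D "D *v v"] s by (simp add: power2_eq_square)
  then have "(norm ?u)\<^sup>2 \<le> (?s\<^sup>2)\<^sup>2" by (rule power_mono) simp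
  moreover have "?u \<bullet> v = ?s\<^sup>2"
    using self_adjoint_inner[OF assms, of "D *v v" v] s by (simp add: dot_square_norm)
  moreover have "(norm (x - a *\<^sub>R v))\<^sup>2 = (norm x)\<^sup>2 - 2 * a * (x \<bullet> v) + a\<^sup>2" for x a
  proof -
    have "v \<bullet> v = 1" using v by (simp add: norm_eq_1)
    then show ?thesis
      unfolding power2_norm_eq_inner
      by (simp add: inner_diff_left inner_diff_right inner_commute[of v x] power2_eq_square algebra_simps)
  qed
  ultimately have "(norm (?u - ?s\<^sup>2 *\<^sub>R v))\<^sup>2 \<le> 0"
    by (simp add: power2_eq_square)
  then have u: "?u = ?s\<^sup>2 *\<^sub>R v" by simp
  let ?w = "D *v v + ?s *\<^sub>R v"
  have of_real_smult: "of_real r *s x = r *\<^sub>R x" for r and x :: "complex^'n"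
    by (simp add: vec_eq_iff scaleR_conv_of_real[where x = "_ :: complex"])
  show thesis
  proof (cases "?w = 0")
    case True
    then have "D *v v = of_real (- ?s) *s v" unfolding of_real_smult by (simp add: eq_neg_iff_add_eq_0)
    moreover have "v \<noteq> 0" using v by auto
    ultimately have "meigenvalue D (of_real (- ?s))" unfolding meigenvalue_def by blast
    then show thesis by (rule that[rotated]) (simp add: opnorm_nonneg)
  next
    case False
    have "D *v ?w = of_real ?s *s ?w"
      unfolding of_real_smult by (simp add: matrix_vector_right_distrib linear_scale[OF matrix_vector_mul_linear] u
          scaleR_right_distrib power2_eq_square)
    then have "meigenvalue D (of_real ?s)" using False unfolding meigenvalue_def by blast
    then show thesis by (rule that[rotated]) (simp add: opnorm_nonneg)
  qed
qed

lemma linear_mdagger: "linear mdagger"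
  by (rule linearI) (simp_all add: vec_eq_iff mdagger_def transpose_def)

lemma mdagger_mul: "mdagger (M ** N) = mdagger N ** mdagger M"
  by (simp add: vec_eq_iff mdagger_def transpose_def matrix_matrix_mult_def mult.commute)

lemma mdagger_mat_1: "mdagger (mat 1) = mat 1"
  by (auto simp: vec_eq_iff mdagger_def transpose_def mat_def)

lemma self_adjoint_mexp:
  assumes "self_adjoint D"
  shows "self_adjoint (mexp D)"
proof -
  have D: "mdagger D = D" using assms by (simp add: self_adjoint_def)
  have "mdagger (mpow D k) = mpow D k" for k
    by (induction k) (simp_all add: mdagger_mat_1 mdagger_mul D mpow_commute)
  then have "mdagger (exp_term D k) = exp_term D k" for k
    by (simp add: exp_term_def linear_scale[OF linear_mdagger])
  then have "exp_term D sums mdagger (mexp D)"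
    using linear_sums[OF linear_mdagger exp_term_sums, of D] by simp
  then show ?thesis
    using exp_term_sums sums_unique2 unfolding self_adjoint_def by blast
qed

section \<open>The deviation step\<close>

definition dev_step :: "complex^'n^'n \<Rightarrow> complex^'n^'n"
  where "dev_step D = mexp (- D) - mat 1 + D"

text \<open>
  The action of the deviation step on eigenvalues.
\<close>

definition step_fun :: "real \<Rightarrow> real"
  where "step_fun x = exp (- x) - 1 + x"

lemma step_fun_nonneg: "0 \<le> step_fun x"
  using exp_ge_add_one_self[of "- x"] by (simp add: step_fun_def)

lemma step_fun_mono:
  assumes "0 \<le> x" "x \<le> y"
  shows "step_fun x \<le> step_fun y"
proof -
  have "exp (- x) - exp (- y) = exp (- x) * (1 - exp (- (y - x)))"
    by (simp add: right_diff_distrib flip: exp_add)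
  also have "\<dots> \<le> 1 * (y - x)"
  proof (rule mult_mono)
    show "1 - exp (- (y - x)) \<le> y - x"
      using exp_ge_add_one_self[of "- (y - x)"] by linarith
  qed (use assms in auto)
  finally show ?thesis by (simp add: step_fun_def)
qed

lemma step_fun_less: "0 < x \<Longrightarrow> step_fun x < x"
  by (simp add: step_fun_def)

lemma self_adjoint_dev_step:
  assumes "self_adjoint D"
  shows "self_adjoint (dev_step D)"
proof -
  have "self_adjoint (mexp (- D))"
    using assms by (intro self_adjoint_mexp) (simp add: self_adjoint_def linear_neg[OF linear_mdagger])
  with assms show ?thesis
    by (simp add: self_adjoint_def dev_step_def mdagger_mat_1
        linear_add[OF linear_mdagger] linear_diff[OF linear_mdagger])
qed

text \<open>
  The eigenspace of the new deviation is invariant under $D$, because the two matrices commute, so it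
  contains an eigenvector of $D$; on that vector the step acts as the scalar function.
\<close>

lemma eigenvalue_dev_step:
  assumes D: "self_adjoint D" and ev: "meigenvalue (dev_step D) \<mu>"
  obtains x where "meigenvalue D (of_real x)" "\<mu> = of_real (step_fun x)" "\<bar>x\<bar> \<le> opnorm D"
proof -
  interpret complex_operator "(*s)" "(*v) D" by (rule complex_operator_apply)
  define V where "V = {w. dev_step D *v w = \<mu> *s w}"
  obtain v where v: "v \<in> V" "v \<noteq> 0"
    using ev by (auto simp: V_def meigenvalue_def)
  have "mexp (- D) ** D = D ** mexp (- D)"
    by (rule mexp_intertwine) (simp add: mul_left_neg mul_right_neg)
  then have comm: "dev_step D ** D = D ** dev_step D"
    by (simp add: dev_step_def mul_right_add mul_right_diff matrix_add_ldistrib mul_left_diff)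
  have "D *v w - c *s w \<in> V" if "w \<in> V" for w c
  proof -
    have "dev_step D *v (D *v w) = D *v (dev_step D *v w)"
      by (simp add: matrix_vector_mul_assoc comm)
    with that show ?thesis
      by (simp add: V_def vec.diff vec.scale vec.scale_right_diff_distrib mult.commute)
  qed
  then obtain cs where cs: "shift_prod cs v = 0"
    "\<And>c. c \<in> set cs \<Longrightarrow> \<exists>w\<in>V. w \<noteq> 0 \<and> D *v w = c *s w"
    using ex_shift_prod_eigenvalues[OF v(1)] by metis
  from cs(1) v(2) have "cs \<noteq> []" by auto
  then obtain c w where w: "w \<in> V" "w \<noteq> 0" "D *v w = c *s w"
    using cs(2)[of "hd cs"] by auto
  define x where "x = Re c"
  have c: "c = of_real x"
    unfolding x_def using self_adjoint_eigenvalue_real[OF D w(3,2)] .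
  have "(- D) *v w = (- c) *s w"
    by (simp add: linear_neg[OF linear_matrix_apply] w(3) vec_eq_iff)
  from mexp_apply_eigenvector[OF this]
  have "dev_step D *v w = (exp (- c) - 1 + c) *s w"
    by (simp add: dev_step_def matrix_vector_mult_add_rdistrib matrix_vector_mult_diff_rdistrib
        w(3) vec_eq_iff algebra_simps)
  then have "\<mu> *s w = of_real (step_fun x) *s w"
    using w(1) by (simp add: V_def c step_fun_def exp_of_real flip: of_real_minus)
  then have "\<mu> = of_real (step_fun x)" using w(2) by (auto simp: vec_eq_iff)
  moreover have "meigenvalue D (of_real x)"
    using w c unfolding meigenvalue_def by auto
  moreover have "\<bar>x\<bar> \<le> opnorm D"
    using eigenvalue_le_opnorm[OF w(3,2)] c by simp
  ultimately show thesis using that by blast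
qed

text \<open>
  All that the norm estimate needs of a positive semidefinite deviation. For a self-adjoint matrix it
  is equivalent to positive semidefiniteness, but it is read off directly from the eigenvalues of a
  deviation step.
\<close>

definition nonneg_spectrum :: "complex^'n^'n \<Rightarrow> bool"
  where "nonneg_spectrum D \<longleftrightarrow> (\<forall>x. meigenvalue D (of_real x) \<longrightarrow> 0 \<le> x)"

lemma nonneg_spectrum_dev_step:
  assumes "self_adjoint D"
  shows "nonneg_spectrum (dev_step D)"
  unfolding nonneg_spectrum_def
  by (metis eigenvalue_dev_step[OF assms] of_real_eq_iff step_fun_nonneg)

lemma pos_semidef_nonneg_spectrum:
  assumes "pos_semidef D"
  shows "nonneg_spectrum D"
  unfolding nonneg_spectrum_def
proof (intro allI impI)
  fix x
  assume "meigenvalue D (of_real x)"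
  then obtain w where w: "w \<noteq> 0" "D *v w = of_real x *s w" by (auto simp: meigenvalue_def)
  have "0 \<le> Re (\<Sum>i\<in>UNIV. cnj (w $ i) * (D *v w) $ i)"
    using assms by (simp add: pos_semidef_def)
  also have "\<dots> = x * (w \<bullet> w)"
    by (simp add: w(2) inner_vec_def inner_complex_def sum_distrib_left algebra_simps)
  finally have "0 \<le> x * (w \<bullet> w)" .
  moreover have "0 < w \<bullet> w" using \<open>w \<noteq> 0\<close> by simp
  ultimately show "0 \<le> x" by (simp add: zero_le_mult_iff)
qed

text \<open>
  The norm of the new deviation is the value of the scalar function at some eigenvalue of the old one;
  monotonicity on the non-negative axis, where these eigenvalues lie, moves it to the largest
  possible place.
\<close>

lemma opnorm_dev_step_le:
  assumes "self_adjoint D" "nonneg_spectrum D"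
  shows "opnorm (dev_step D) \<le> step_fun (opnorm D)"
proof -
  obtain \<mu> where \<mu>: "\<bar>\<mu>\<bar> = opnorm (dev_step D)" "meigenvalue (dev_step D) (of_real \<mu>)"
    using self_adjoint_opnorm_eigenvalue[OF self_adjoint_dev_step[OF assms(1)]] .
  obtain x where x: "meigenvalue D (of_real x)" "complex_of_real \<mu> = of_real (step_fun x)" "\<bar>x\<bar> \<le> opnorm D"
    using eigenvalue_dev_step[OF assms(1) \<mu>(2)] .
  have "0 \<le> x" using assms(2) x(1) by (simp add: nonneg_spectrum_def)
  have "opnorm (dev_step D) = step_fun x"
    using \<mu>(1) x(2) step_fun_nonneg[of x] by simp
  also have "\<dots> \<le> step_fun (opnorm D)"
    using \<open>0 \<le> x\<close> x(3) by (intro step_fun_mono) auto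
  finally show ?thesis .
qed

text \<open>
  The sequence decreases to a limit $l \<ge> 0$ with $l \<le> f(l)$, and $f(x) < x$ for $x > 0$. Since
  $f(x)/x$ tends to $1$ as $x$ grows, no contraction factor is uniform in the starting point.
\<close>

lemma step_fun_iteration_tendsto_0:
  fixes d :: "nat \<Rightarrow> real"
  assumes nonneg: "\<And>n. 0 \<le> d n" and step: "\<And>n. d (Suc n) \<le> step_fun (d n)"
  shows "d \<longlonglongrightarrow> 0"
proof -
  have le: "step_fun x \<le> x" if "0 \<le> x" for x
    using that by (simp add: step_fun_def)
  have "decseq d"
    unfolding decseq_Suc_iff using step le[OF nonneg] order_trans by blast
  then obtain l where l: "d \<longlonglongrightarrow> l"
    using decseq_convergent[of d 0] nonneg by blast
  have "0 \<le> l" using l nonneg by (simp add: LIMSEQ_le_const)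
  have "(\<lambda>n. step_fun (d n)) \<longlonglongrightarrow> step_fun l"
    unfolding step_fun_def by (intro tendsto_intros l)
  with LIMSEQ_Suc[OF l] have "l \<le> step_fun l"
    using step by (intro LIMSEQ_le[of "\<lambda>n. d (Suc n)" l]) auto
  with \<open>0 \<le> l\<close> have "l = 0" using step_fun_less[of l] by linarith
  with l show ?thesis by simp
qed

lemma tendsto_0_if_opnorm:
  fixes D :: "nat \<Rightarrow> complex^'n^'n"
  assumes "(\<lambda>n. opnorm (D n)) \<longlonglongrightarrow> 0"
  shows "D \<longlonglongrightarrow> 0"
proof (intro vec_tendstoI)
  fix i j
  have "(\<lambda>n. D n $ i $ j) \<longlonglongrightarrow> 0"
    by (rule Lim_null_comparison[OF _ assms]) (simp add: norm_entry_le_opnorm)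
  then show "(\<lambda>n. D n $ i $ j) \<longlonglongrightarrow> 0 $ i $ j" by simp
qed

text \<open>
  Commutation turns $e^L e^{-(L+D)}$ into $e^{-D}$, so the logarithm drops out of the recursion.
\<close>

lemma deviation_step:
  fixes L D :: "complex^'n^'n"
  assumes "L ** D = D ** L"
  shows "mexp L ** mexp (- (L + D)) - mat 1 + (L + D) - L = dev_step D"
proof -
  have "mexp (L + - (L + D)) = mexp L ** mexp (- (L + D))"
    using assms by (intro mexp_add) (simp add: mul_left_neg mul_right_neg mul_left_diff mul_right_diff)
  then show ?thesis by (simp add: dev_step_def)
qed

lemma dev_step_commute:
  assumes "L ** D = D ** L"
  shows "L ** dev_step D = dev_step D ** L"
proof -
  have "mexp (- D) ** L = L ** mexp (- D)"
    using assms by (intro mexp_intertwine) (simp add: mul_left_neg mul_right_neg)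
  with assms show ?thesis
    by (simp add: dev_step_def mul_right_add mul_right_diff matrix_add_ldistrib mul_left_diff)
qed

section \<open>Convergence to the logarithm\<close>

theorem mainTheorem1:
  fixes A \<Delta>\<^sub>0 :: "complex^'n^'n" and X :: "nat \<Rightarrow> complex^'n^'n"
  assumes "has_mlog A"
    and "self_adjoint \<Delta>\<^sub>0"
    and "commutator \<Delta>\<^sub>0 A = 0"
    and "X 0 = mlog A + \<Delta>\<^sub>0"
    and "\<And>n. X (Suc n) = A ** mexp (- X n) - mat 1 + X n"
  shows "(\<forall>n. (n \<ge> 1 \<or> pos_semidef \<Delta>\<^sub>0) \<and> X n - mlog A \<noteq> 0 \<longrightarrow>
            opnorm (X (Suc n) - mlog A) < opnorm (X n - mlog A))
       \<and> X \<longlonglongrightarrow> mlog A"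
proof -
  obtain L where L: "is_mlog A L" using assms(1) by (auto simp: has_mlog_def)
  then have logA: "mlog A = L" by (rule mlog_eq)
  have A: "A = mexp L" using L by (simp add: is_mlog_def)
  define D where "D n = X n - L" for n
  have X: "X n = L + D n" for n by (simp add: D_def)
  have D0: "D 0 = \<Delta>\<^sub>0" using assms(4) by (simp add: D_def logA)
  have "mexp L ** \<Delta>\<^sub>0 = \<Delta>\<^sub>0 ** mexp L"
    using assms(3) by (simp add: commutator_def A)
  then have comm0: "L ** \<Delta>\<^sub>0 = \<Delta>\<^sub>0 ** L"
    using L intertwine_of_mexp_intertwine[of L L \<Delta>\<^sub>0] by (simp add: is_mlog_def)
  have inv: "self_adjoint (D n) \<and> L ** D n = D n ** L \<and> D (Suc n) = dev_step (D n)" for n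
  proof -
    have step: "D (Suc n) = dev_step (D n)" if "L ** D n = D n ** L" for n
      using deviation_step[OF that] assms(5)[of n] by (simp add: D_def A)
    show ?thesis
    proof (induction n)
      case 0
      show ?case using D0 comm0 assms(2) step by simp
    next
      case (Suc n)
      then show ?case
        using step self_adjoint_dev_step dev_step_commute by metis
    qed
  qed
  have spec: "nonneg_spectrum (D n)" if "n \<ge> 1 \<or> pos_semidef \<Delta>\<^sub>0" for n
    using that inv D0
    by (cases n) (auto intro: nonneg_spectrum_dev_step pos_semidef_nonneg_spectrum)
  have le: "opnorm (D (Suc n)) \<le> step_fun (opnorm (D n))" if "n \<ge> 1 \<or> pos_semidef \<Delta>\<^sub>0" for n
    using opnorm_dev_step_le[of "D n"] spec[OF that] inv by simp
  have "opnorm (D (Suc n)) < opnorm (D n)"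
    if "n \<ge> 1 \<or> pos_semidef \<Delta>\<^sub>0" "D n \<noteq> 0" for n
    using le[OF that(1)] step_fun_less[OF opnorm_pos[OF that(2)]] by simp
  moreover have "(\<lambda>n. opnorm (D (Suc n))) \<longlonglongrightarrow> 0"
    by (rule step_fun_iteration_tendsto_0) (simp_all add: opnorm_nonneg le)
  then have "D \<longlonglongrightarrow> 0"
    using tendsto_0_if_opnorm[of "\<lambda>n. D (Suc n)"] by (simp add: filterlim_sequentially_Suc)
  then have "X \<longlonglongrightarrow> L"
    using tendsto_add[OF tendsto_const, of D 0 sequentially L] by (simp add: X[abs_def])
  ultimately show ?thesis
    by (auto simp: logA D_def)
qed

end
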